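(* As formal power series in independent variables $q$ and $x$, \[ \sum_{\pi\in\mathcal{RR}} x^{\nu(\pi)} q^{|\pi|} \;=\; \sum_{\substack{\pi\in\mathcal{D}\\ s_e(\pi) > 2 \nu_o(\pi)}} x^{\nu(\pi)} q^{|\pi|}. \] Equivalently, for all integers $N,m\ge 0$, the number of partitions of $N$ into exactly $m$ parts with difference at least $2$ between consecutive parts equals the number of partitions of $N$ into exactly $m$ distinct parts whose smallest even part (if any) exceeds twice the number of odd parts.
   Context: A partition $\pi$ is a finite non-increasing sequence of positive integers (its parts); $|\pi|$ is the sum of its parts and $\nu(\pi)$ the number of parts; the empty partition is allowed. $\mathcal{D}$ is the set of partitions into distinct parts (consecutive parts differ by at least $1$), and $\mathcal{RR}$ is the set of partitions in which consecutive parts differ by at least $2$. $\nu_o(\pi)$ is the number of odd parts of $\pi$, and $s_e(\pi)$ is the smallest even part of $\pi$, with $s_e(\pi)=\infty$ if $\pi$ has no even part. *)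

theory Defs
  imports "HOL-Analysis.Infinite_Sum" "HOL-Library.Extended_Nat"
    "HOL-Computational_Algebra.Formal_Power_Series"
begin

definition partitions :: "nat list set" where
  "partitions = {\<pi>. sorted_wrt (\<ge>) \<pi> \<and> (\<forall>k\<in>set \<pi>. 0 < k)}"

abbreviation weight :: "nat list \<Rightarrow> nat" where
  "weight \<pi> \<equiv> sum_list \<pi>"

abbreviation num_parts :: "nat list \<Rightarrow> nat" where
  "num_parts \<pi> \<equiv> length \<pi>"

text \<open>\<open>a\<close> is the part preceding \<open>b\<close>, so \<open>d + b \<le> a\<close> says that the consecutive
  parts differ by at least \<open>d\<close>.\<close>

definition gap_partitions :: "nat \<Rightarrow> nat list set" where
  "gap_partitions d = {\<pi> \<in> partitions. successively (\<lambda>a b. d + b \<le> a) \<pi>}"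

abbreviation distinct_partitions :: "nat list set" where
  "distinct_partitions \<equiv> gap_partitions 1"

abbreviation RR_partitions :: "nat list set" where
  "RR_partitions \<equiv> gap_partitions 2"

definition num_odd_parts :: "nat list \<Rightarrow> nat" where
  "num_odd_parts \<pi> = length (filter odd \<pi>)"

definition smallest_even_part :: "nat list \<Rightarrow> enat" where
  "smallest_even_part \<pi> =
     (if \<exists>k\<in>set \<pi>. even k then enat (Min {k \<in> set \<pi>. even k}) else \<infinity>)"

definition even_above_odd_partitions :: "nat list set" where
  "even_above_odd_partitions =
     {\<pi> \<in> distinct_partitions. smallest_even_part \<pi> > enat (2 * num_odd_parts \<pi>)}"

text \<open>A power series in \<open>q\<close> and \<open>x\<close> is a power series in \<open>q\<close> (the outer variable) whose
  coefficients are power series in \<open>x\<close>. Sums over infinite sets of partitions are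
  limits in the library's topology on formal power series: the coefficient of
  every power of \<open>q\<close> must eventually be constant along the finite partial sums.\<close>

abbreviation var_q :: "int fps fps" where
  "var_q \<equiv> fps_X"

abbreviation var_x :: "int fps fps" where
  "var_x \<equiv> fps_const fps_X"

definition partition_monomial :: "nat list \<Rightarrow> int fps fps" where
  "partition_monomial \<pi> = var_x ^ num_parts \<pi> * var_q ^ weight \<pi>"

text \<open>The cardinality of an infinite set is 0 in the library; the sets counted by
  weight and number of parts are finite.\<close>

lemma finite_partitions_weight: "finite {\<pi> \<in> partitions. weight \<pi> = N}"
proof (rule finite_subset)
  show "{\<pi> \<in> partitions. weight \<pi> = N} \<subseteq> {\<pi>. set \<pi> \<subseteq> {..N} \<and> length \<pi> \<le> N}"
  proof
    fix \<pi> assume "\<pi> \<in> {\<pi> \<in> partitions. weight \<pi> = N}"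
    then have pos: "\<forall>k\<in>set \<pi>. 0 < k" and N: "weight \<pi> = N"
      by (auto simp: partitions_def)
    have "length \<pi> \<le> sum_list \<pi>"
      using pos by (induction \<pi>) auto
    then show "\<pi> \<in> {\<pi>. set \<pi> \<subseteq> {..N} \<and> length \<pi> \<le> N}"
      using N member_le_sum_list by auto
  qed
  show "finite {\<pi>. set \<pi> \<subseteq> {..N} \<and> length \<pi> \<le> N}"
    by (rule finite_lists_length_le) simp
qed

end

theory Submission
  imports Defs
begin

text \<open>Bressoud's bijection. Subtracting the staircase \<open>2m - 1, \<dots>, 3, 1\<close> identifies
  the partitions in \<open>RR\<close> with \<open>m\<close> parts with the non-increasing lists of \<open>m\<close> natural
  numbers (zeros allowed). If such a list has \<open>n\<close> even and \<open>r\<close> odd entries, then adding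
  \<open>2n - 1, \<dots>, 3, 1\<close> to the even ones gives arbitrary distinct odd parts, and adding
  \<open>2(n + r) - 1, \<dots>, 2n + 1\<close> to the odd ones gives arbitrary distinct even parts
  exceeding \<open>2n\<close>. The two staircases together have weight
  \<open>n\<^sup>2 + (2nr + r\<^sup>2) = m\<^sup>2\<close>, the weight of the original one.\<close>

section \<open>Adding a staircase with step 2 to a list\<close>

primrec add_staircase :: "nat \<Rightarrow> nat list \<Rightarrow> nat list" where
  "add_staircase c [] = []"
| "add_staircase c (x # xs) = (x + c + 2 * length xs) # add_staircase c xs"

lemma length_add_staircase [simp]: "length (add_staircase c xs) = length xs"
  by (induction xs) auto

text \<open>The added terms \<open>c, c + 2, ...\<close> sum to \<open>l * c + l * (l - 1)\<close>
  for length \<open>l\<close>. Moving \<open>l\<close> to the left keeps truncated subtraction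
  out.\<close>

lemma sum_list_add_staircase:
  "sum_list (add_staircase c xs) + length xs = sum_list xs + length xs * c + (length xs)\<^sup>2"
  by (induction xs) (auto simp: power2_eq_square algebra_simps)

text \<open>Length is preserved, so two lists with the same image have their heads shifted by the
  same amount.\<close>

lemma inj_add_staircase: "inj (add_staircase c)"
proof (rule injI)
  fix xs ys assume "add_staircase c xs = add_staircase c ys"
  then show "xs = ys"
  proof (induction xs arbitrary: ys)
    case Nil
    then show ?case by (cases ys) auto
  next
    case (Cons x xs)
    then obtain z zs where "ys = z # zs" by (cases ys) auto
    moreover from this Cons.prems have "length xs = length zs"
      by (metis add_staircase.simps(2) length_add_staircase list.inject)
    ultimately show ?case using Cons by auto
  qed
qed

text \<open>Every entry is shifted by \<open>c\<close> plus an even number, so only the parity of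
  \<open>c\<close> matters.\<close>

lemma even_add_staircase:
  "(\<forall>y\<in>set (add_staircase c xs). even y) \<longleftrightarrow> (\<forall>x\<in>set xs. even (x + c))"
  "(\<forall>y\<in>set (add_staircase c xs). odd y) \<longleftrightarrow> (\<forall>x\<in>set xs. odd (x + c))"
  by (induction xs) auto

text \<open>The gap relation is transitive. The pairwise form is the convenient one because it
  passes to filtered sublists.\<close>

lemma sorted_wrt_gap_conv_successively:
  "sorted_wrt (\<lambda>a b. d + b \<le> a) xs \<longleftrightarrow> successively (\<lambda>a b. d + b \<le> a) xs" for xs :: "nat list"
  by (rule successively_conv_sorted_wrt[symmetric]) (auto intro!: transpI)

text \<open>The staircase has smallest term \<open>c\<close> and steps of 2. Used with
  \<open>c = 1\<close> for the RR partitions and for odd parts, and with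
  \<open>c = 2 * n + 1\<close> for even parts.\<close>

lemma add_staircase_image:
  "add_staircase c ` {xs. sorted_wrt (\<ge>) xs} =
     {ys. sorted_wrt (\<lambda>a b. 2 + b \<le> a) ys \<and> (\<forall>y\<in>set ys. c \<le> y)}"
proof (intro equalityI subsetI)
  fix ys assume "ys \<in> add_staircase c ` {xs. sorted_wrt (\<ge>) xs}"
  then obtain xs where xs: "sorted_wrt (\<ge>) xs" "ys = add_staircase c xs"
    by auto
  then have "successively (\<lambda>a b. 2 + b \<le> a) ys \<and> (\<forall>y\<in>set ys. c \<le> y)"
  proof (induction xs arbitrary: ys)
    case (Cons x xs)
    then show ?case by (cases xs) auto
  qed simp
  then show "ys \<in> {ys. sorted_wrt (\<lambda>a b. 2 + b \<le> a) ys \<and> (\<forall>y\<in>set ys. c \<le> y)}"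
    unfolding sorted_wrt_gap_conv_successively by simp
next
  fix ys assume "ys \<in> {ys. sorted_wrt (\<lambda>a b. 2 + b \<le> a) ys \<and> (\<forall>y\<in>set ys. c \<le> y)}"
  then have "sorted_wrt (\<lambda>a b. 2 + b \<le> a) ys" "\<forall>y\<in>set ys. c \<le> y"
    by auto
  then show "ys \<in> add_staircase c ` {xs. sorted_wrt (\<ge>) xs}"
  proof (induction ys)
    case Nil
    show ?case by (intro image_eqI[of _ _ "[]"]) auto
  next
    case (Cons y ys)
    then obtain xs where xs: "sorted_wrt (\<ge>) xs" "ys = add_staircase c xs"
      by auto
    \<comment> \<open>The head of the preimage is found by subtraction; the second conjunct ensures
      that this subtraction is not truncated.\<close>
    have "sorted_wrt (\<ge>) ((y - c - 2 * length xs) # xs) \<and> c + 2 * length xs \<le> y"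
    proof (cases xs)
      case (Cons z zs)
      then have "2 + (z + c + 2 * length zs) \<le> y" and "\<forall>w\<in>set zs. w \<le> z"
        using xs Cons.prems by auto
      then show ?thesis using xs Cons by force
    qed (use Cons.prems in auto)
    then show ?case
      using xs by (intro image_eqI[of _ _ "(y - c - 2 * length xs) # xs"]) auto
  qed
qed

section \<open>Merging and splitting decreasing lists\<close>

definition merge_desc :: "'a::linorder list \<Rightarrow> 'a list \<Rightarrow> 'a list" where
  "merge_desc xs ys = rev (sort (xs @ ys))"

lemma sorted_merge_desc: "sorted_wrt (\<ge>) (merge_desc xs ys)"
  by (simp add: merge_desc_def sorted_wrt_rev)

lemma mset_merge_desc: "mset (merge_desc xs ys) = mset xs + mset ys"
  by (simp add: merge_desc_def)

lemma sorted_desc_eqI: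
  fixes xs ys :: "'a::linorder list"
  assumes "sorted_wrt (\<ge>) xs" "sorted_wrt (\<ge>) ys" "mset xs = mset ys"
  shows "xs = ys"
proof -
  have "sort (rev ys) = rev xs" "sort (rev ys) = rev ys"
    using assms by (auto intro!: properties_for_sort simp: sorted_wrt_rev)
  then show ?thesis by simp
qed

text \<open>Each filtered list is decreasing and has the multiset of one of the pieces, which
  determines it. Thus filtering undoes merging.\<close>

lemma filter_merge_desc:
  assumes "sorted_wrt (\<ge>) xs" "sorted_wrt (\<ge>) ys" "\<forall>x\<in>set xs. P x" "\<forall>y\<in>set ys. \<not> P y"
  shows "filter P (merge_desc xs ys) = xs" "filter (\<lambda>x. \<not> P x) (merge_desc xs ys) = ys"
proof -
  have "mset (filter P (merge_desc xs ys)) = mset (filter P xs) + mset (filter P ys)"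
    "mset (filter (\<lambda>x. \<not> P x) (merge_desc xs ys)) =
      mset (filter (\<lambda>x. \<not> P x) xs) + mset (filter (\<lambda>x. \<not> P x) ys)"
    by (simp_all add: mset_merge_desc)
  moreover have "filter P xs = xs" "filter P ys = []"
    "filter (\<lambda>x. \<not> P x) xs = []" "filter (\<lambda>x. \<not> P x) ys = ys"
    using assms(3,4) by (auto simp: filter_id_conv filter_empty_conv)
  ultimately show "filter P (merge_desc xs ys) = xs" "filter (\<lambda>x. \<not> P x) (merge_desc xs ys) = ys"
    using assms(1,2) by (auto intro!: sorted_desc_eqI sorted_wrt_filter sorted_merge_desc simp del: mset_filter)
qed

lemma sorted_desc_eqI_filter:
  fixes xs ys :: "'a::linorder list"
  assumes "sorted_wrt (\<ge>) xs" "sorted_wrt (\<ge>) ys"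
    and "filter P xs = filter P ys" "filter (\<lambda>x. \<not> P x) xs = filter (\<lambda>x. \<not> P x) ys"
  shows "xs = ys"
proof (rule sorted_desc_eqI)
  show "mset xs = mset ys"
    using assms(3,4) by (metis mset_filter multiset_partition)
qed (use assms in auto)


lemma sorted_wrt_greater_imp_distinct:
  "sorted_wrt (>) xs \<Longrightarrow> distinct xs" for xs :: "'a::linorder list"
  by (induction xs) auto

lemma sorted_desc_distinct:
  "sorted_wrt (\<ge>) xs \<Longrightarrow> distinct xs \<Longrightarrow> sorted_wrt (>) xs" for xs :: "'a::linorder list"
  by (induction xs) (auto simp: order.strict_iff_order)

text \<open>Equal entries satisfy \<open>P\<close> together or fail it together, so a repetition
  would survive in one of the two filtered lists.\<close>

lemma distinct_filter_split:
  "distinct (filter P xs) \<Longrightarrow> distinct (filter (\<lambda>x. \<not> P x) xs) \<Longrightarrow> distinct xs"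
  by (induction xs) (auto split: if_splits)

section \<open>The two classes of partitions\<close>

lemma gap_partitions_iff:
  "\<pi> \<in> gap_partitions d \<longleftrightarrow> sorted_wrt (\<lambda>a b. d + b \<le> a) \<pi> \<and> (\<forall>k\<in>set \<pi>. 0 < k)"
  by (auto simp: gap_partitions_def partitions_def sorted_wrt_gap_conv_successively[symmetric]
      intro: sorted_wrt_mono_rel[rotated])

text \<open>With \<open>c = 1\<close> the lower bound on the entries is positivity of the
  parts.\<close>

lemma bij_betw_staircase_RR:
  "bij_betw (add_staircase 1) {xs. sorted_wrt (\<ge>) xs} RR_partitions"
proof (rule bij_betw_imageI)
  show "inj_on (add_staircase 1) {xs. sorted_wrt (\<ge>) xs}"
    using inj_add_staircase by (rule inj_on_subset) simp
  show "add_staircase 1 ` {xs. sorted_wrt (\<ge>) xs} = RR_partitions"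
    unfolding add_staircase_image by (auto simp: gap_partitions_iff Suc_le_eq)
qed

lemma even_above_odd_iff:
  "\<pi> \<in> even_above_odd_partitions \<longleftrightarrow>
     sorted_wrt (>) \<pi> \<and> (\<forall>k\<in>set \<pi>. even k \<longrightarrow> 2 * length (filter odd \<pi>) < k)"
proof -
  have "smallest_even_part \<pi> > enat (2 * num_odd_parts \<pi>) \<longleftrightarrow>
      (\<forall>k\<in>set \<pi>. even k \<longrightarrow> 2 * length (filter odd \<pi>) < k)"
  proof (cases "\<exists>k\<in>set \<pi>. even k")
    case True
    then have "{k \<in> set \<pi>. even k} \<noteq> {}"
      by blast
    then show ?thesis
      using True by (auto simp: smallest_even_part_def num_odd_parts_def)
  qed (auto simp: smallest_even_part_def)
  \<comment> \<open>A part 0 would be even and would have to exceed a natural number, so the bound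
    forces positive parts.\<close>
  moreover have "0 < k" if "\<forall>k\<in>set \<pi>. even k \<longrightarrow> 2 * length (filter odd \<pi>) < k" "k \<in> set \<pi>" for k
    using that by (cases "k = 0") auto
  ultimately show ?thesis
    by (auto simp: even_above_odd_partitions_def gap_partitions_iff Suc_le_eq)
qed

section \<open>Bressoud's map and its bijectivity\<close>

text \<open>Both offsets are odd, so parities are swapped: the number of even entries becomes the
  number of odd parts, and the second offset is the least odd number above twice that count.\<close>

definition bressoud :: "nat list \<Rightarrow> nat list" where
  "bressoud xs = merge_desc (add_staircase 1 (filter even xs))
     (add_staircase (2 * length (filter even xs) + 1) (filter odd xs))"

lemma sorted_add_staircase:
  assumes "sorted_wrt (\<ge>) xs"
  shows "sorted_wrt (\<lambda>a b. 2 + b \<le> a) (add_staircase c xs)" "\<forall>y\<in>set (add_staircase c xs). c \<le> y"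
  using assms add_staircase_image[of c] by blast+

lemma filter_bressoud:
  assumes "sorted_wrt (\<ge>) xs"
  shows "filter odd (bressoud xs) = add_staircase 1 (filter even xs)"
    and "filter even (bressoud xs) =
      add_staircase (2 * length (filter even xs) + 1) (filter odd xs)"
proof -
  have *: "sorted_wrt (\<ge>) (add_staircase c (filter P xs))" for c P
    using sorted_add_staircase(1)[OF sorted_wrt_filter[OF assms]]
    by (rule sorted_wrt_mono_rel[rotated]) auto
  have odd: "\<forall>y\<in>set (add_staircase 1 (filter even xs)). odd y"
    unfolding even_add_staircase by simp
  have even: "\<forall>y\<in>set (add_staircase (2 * length (filter even xs) + 1) (filter odd xs)). \<not> odd y"
    unfolding not_not even_add_staircase by simp
  show "filter odd (bressoud xs) = add_staircase 1 (filter even xs)"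
    "filter even (bressoud xs) = add_staircase (2 * length (filter even xs) + 1) (filter odd xs)"
    using filter_merge_desc[OF * * odd even] by (simp_all add: bressoud_def)
qed

lemma length_bressoud: "length (bressoud xs) = length xs"
  using sum_length_filter_compl[of even xs] by (simp add: bressoud_def merge_desc_def)

lemma sum_list_filter_add:
  "sum_list (filter P xs) + sum_list (filter (\<lambda>x. \<not> P x) xs) = sum_list xs" for xs :: "nat list"
  by (induction xs) auto

text \<open>Together with \<open>length_bressoud\<close>, this gives both images of a decreasing
  list the same monomial.\<close>

lemma sum_list_bressoud: "sum_list (bressoud xs) = sum_list (add_staircase 1 xs)"
proof -
  let ?n = "length (filter even xs)" and ?r = "length (filter odd xs)"
  have "sum_list (bressoud xs) = sum_list (add_staircase 1 (filter even xs)) +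
      sum_list (add_staircase (2 * ?n + 1) (filter odd xs))"
    by (simp add: bressoud_def flip: sum_mset_sum_list add: mset_merge_desc)
  moreover have "length xs = ?n + ?r"
    using sum_length_filter_compl[of even xs] by simp
  ultimately show ?thesis
    using sum_list_add_staircase[of 1 "filter even xs"] sum_list_add_staircase[of 1 xs]
      sum_list_add_staircase[of "2 * ?n + 1" "filter odd xs"] sum_list_filter_add[of even xs]
    by (simp add: power2_eq_square algebra_simps)
qed

lemma bij_betw_bressoud:
  "bij_betw bressoud {xs. sorted_wrt (\<ge>) xs} even_above_odd_partitions"
proof (rule bij_betw_imageI)
  show "inj_on bressoud {xs. sorted_wrt (\<ge>) xs}"
  proof (rule inj_onI)
    fix xs ys assume "xs \<in> {xs. sorted_wrt (\<ge>) xs}" "ys \<in> {xs. sorted_wrt (\<ge>) xs}"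
      and eq: "bressoud xs = bressoud ys"
    then have s: "sorted_wrt (\<ge>) xs" "sorted_wrt (\<ge>) ys"
      by auto
    have e: "filter even xs = filter even ys"
      using filter_bressoud(1)[OF s(1)] filter_bressoud(1)[OF s(2)] eq
      by (metis inj_add_staircase injD)
    \<comment> \<open>By \<open>e\<close> the offsets of the second staircase agree, so its
      injectivity applies.\<close>
    have "filter odd xs = filter odd ys"
      using filter_bressoud(2)[OF s(1)] filter_bressoud(2)[OF s(2)] eq e
      by (metis inj_add_staircase injD)
    with s e show "xs = ys"
      by (rule sorted_desc_eqI_filter)
  qed
  show "bressoud ` {xs. sorted_wrt (\<ge>) xs} = even_above_odd_partitions"
  proof (intro equalityI subsetI)
    fix \<pi> assume "\<pi> \<in> bressoud ` {xs. sorted_wrt (\<ge>) xs}"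
    then obtain xs where xs: "sorted_wrt (\<ge>) xs" "\<pi> = bressoud xs"
      by auto
    note f = filter_bressoud[OF xs(1), folded xs(2)]
    have "sorted_wrt (>) (add_staircase c (filter P xs))" for c P
      using sorted_add_staircase(1)[OF sorted_wrt_filter[OF xs(1)]]
      by (rule sorted_wrt_mono_rel[rotated]) simp
    then have "distinct (add_staircase c (filter P xs))" for c P
      by (rule sorted_wrt_greater_imp_distinct)
    then have "distinct (filter odd \<pi>)" "distinct (filter even \<pi>)"
      by (simp_all add: f)
    then have "distinct \<pi>"
      using distinct_filter_split[of odd \<pi>] by simp
    then have "sorted_wrt (>) \<pi>"
      by (intro sorted_desc_distinct) (simp_all add: xs(2) bressoud_def sorted_merge_desc)
    moreover have "2 * length (filter odd \<pi>) < k" if "k \<in> set \<pi>" "even k" for k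
    proof -
      have "k \<in> set (filter even \<pi>)"
        using that by simp
      then show ?thesis
        using sorted_add_staircase(2)[OF sorted_wrt_filter[OF xs(1)]] unfolding f
        by fastforce
    qed
    ultimately show "\<pi> \<in> even_above_odd_partitions"
      by (simp add: even_above_odd_iff)
  next
    fix \<pi> assume "\<pi> \<in> even_above_odd_partitions"
    then have s: "sorted_wrt (>) \<pi>"
      and above: "\<forall>k\<in>set \<pi>. even k \<longrightarrow> 2 * length (filter odd \<pi>) < k"
      by (simp_all add: even_above_odd_iff)
    \<comment> \<open>Distinct numbers of equal parity differ by at least 2, so each parity class of
      parts meets the gap condition.\<close>
    have "2 + b \<le> a" if "b < a" "even a \<longleftrightarrow> even b" for a b :: nat
      using that by presburger
    then have gap: "sorted_wrt (\<lambda>a b. 2 + b \<le> a) (filter odd \<pi>)"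
        "sorted_wrt (\<lambda>a b. 2 + b \<le> a) (filter even \<pi>)"
      by (auto intro!: sorted_wrt_mono_rel[OF _ sorted_wrt_filter[OF s]])
    let ?n = "length (filter odd \<pi>)"
    have "filter odd \<pi> \<in> add_staircase 1 ` {xs. sorted_wrt (\<ge>) xs}"
      unfolding add_staircase_image using gap by (auto simp: Suc_le_eq odd_pos)
    then obtain a where a: "sorted_wrt (\<ge>) a" "filter odd \<pi> = add_staircase 1 a"
      by auto
    \<comment> \<open>The strict bound in \<open>above\<close> is exactly the lower bound
      \<open>2 * ?n + 1\<close>. Since \<open>?n\<close> is also the length of \<open>a\<close>,
      this is the offset that \<open>bressoud\<close> uses on \<open>merge_desc a b\<close>.\<close>
    have "filter even \<pi> \<in> add_staircase (2 * ?n + 1) ` {xs. sorted_wrt (\<ge>) xs}"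
      unfolding add_staircase_image using gap above by (auto simp: Suc_le_eq)
    then obtain b where b: "sorted_wrt (\<ge>) b" "filter even \<pi> = add_staircase (2 * ?n + 1) b"
      by auto
    have pa: "\<forall>x\<in>set a. even x"
      using even_add_staircase(2)[of 1 a] unfolding a(2)[symmetric] by simp
    have pb: "\<forall>x\<in>set b. odd x"
      using even_add_staircase(1)[of "2 * ?n + 1" b] unfolding b(2)[symmetric] by simp
    have m: "filter even (merge_desc a b) = a" "filter odd (merge_desc a b) = b"
      using filter_merge_desc[OF a(1) b(1) pa pb] by auto
    have "\<pi> = bressoud (merge_desc a b)"
    proof (rule sorted_desc_eqI_filter)
      show "sorted_wrt (\<ge>) \<pi>"
        using s by (rule sorted_wrt_mono_rel[rotated]) auto
      show "filter odd \<pi> = filter odd (bressoud (merge_desc a b))"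
        "filter (\<lambda>x. \<not> odd x) \<pi> = filter (\<lambda>x. \<not> odd x) (bressoud (merge_desc a b))"
        using filter_bressoud[OF sorted_merge_desc, of a b] a(2) b(2) m by auto
    qed (simp add: bressoud_def sorted_merge_desc)
    then show "\<pi> \<in> bressoud ` {xs. sorted_wrt (\<ge>) xs}"
      using sorted_merge_desc by blast
  qed
qed

section \<open>Power series and the final identities\<close>

lemma partition_monomial_nth:
  "fps_nth (partition_monomial \<pi>) n = (if weight \<pi> = n then fps_X ^ num_parts \<pi> else 0)"
  by (auto simp: partition_monomial_def fps_X_power_nth fps_const_power)

text \<open>Only finitely many partitions have weight \<open>n\<close>, so the coefficient of
  \<open>q^n\<close> is constant once a partial sum includes all of those in
  \<open>A\<close>.\<close>

lemma partition_monomial_summable: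
  assumes "A \<subseteq> partitions"
  shows "partition_monomial summable_on A"
proof -
  define S where "S n = {\<pi> \<in> A. weight \<pi> = n}" for n
  have fin: "finite (S n)" for n
    by (rule finite_subset[OF _ finite_partitions_weight[of n]]) (use assms in \<open>auto simp: S_def\<close>)
  define F where "F = Abs_fps (\<lambda>n. \<Sum>\<pi>\<in>S n. fps_nth (partition_monomial \<pi>) n)"
  have "(partition_monomial has_sum F) A"
    unfolding has_sum_def
  proof (rule tendsto_fpsI)
    fix n
    have "\<forall>\<^sub>F X in finite_subsets_at_top A. finite X \<and> S n \<subseteq> X \<and> X \<subseteq> A"
      using fin by (intro eventually_finite_subsets_at_top[THEN iffD2] exI[of _ "S n"]) (auto simp: S_def)
    then show "\<forall>\<^sub>F X in finite_subsets_at_top A. fps_nth (sum partition_monomial X) n = fps_nth F n"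
    proof eventually_elim
      case (elim X)
      then have "(\<Sum>\<pi>\<in>S n. fps_nth (partition_monomial \<pi>) n) = (\<Sum>\<pi>\<in>X. fps_nth (partition_monomial \<pi>) n)"
        by (intro sum.mono_neutral_left) (auto simp: S_def partition_monomial_nth)
      then show ?case
        by (simp add: F_def fps_sum_nth)
    qed
  qed
  then show ?thesis
    by (auto simp: summable_on_def)
qed

theorem theorem3:
  shows "partition_monomial summable_on RR_partitions
    \<and> partition_monomial summable_on even_above_odd_partitions
    \<and> (\<Sum>\<^sub>\<infinity>\<pi>\<in>RR_partitions. partition_monomial \<pi>)
        = (\<Sum>\<^sub>\<infinity>\<pi>\<in>even_above_odd_partitions. partition_monomial \<pi>)
    \<and> (\<forall>N m. card {\<pi> \<in> RR_partitions. weight \<pi> = N \<and> num_parts \<pi> = m}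
             = card {\<pi> \<in> even_above_odd_partitions. weight \<pi> = N \<and> num_parts \<pi> = m})"
proof (intro conjI allI)
  let ?desc = "{xs :: nat list. sorted_wrt (\<ge>) xs}"
  \<comment> \<open>An infinite sum defaults to 0 when it does not converge, so summability gives
    the equation its intended meaning.\<close>
  show "partition_monomial summable_on RR_partitions"
    "partition_monomial summable_on even_above_odd_partitions"
    by (rule partition_monomial_summable; auto simp: gap_partitions_def even_above_odd_partitions_def)+
  \<comment> \<open>Both sums are pulled back to decreasing lists of naturals, where they agree term
    by term.\<close>
  have "(\<Sum>\<^sub>\<infinity>\<pi>\<in>RR_partitions. partition_monomial \<pi>) =
      (\<Sum>\<^sub>\<infinity>xs\<in>?desc. partition_monomial (add_staircase 1 xs))"
    by (rule infsum_reindex_bij_betw[OF bij_betw_staircase_RR, symmetric])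
  also have "\<dots> = (\<Sum>\<^sub>\<infinity>xs\<in>?desc. partition_monomial (bressoud xs))"
    by (simp add: partition_monomial_def length_bressoud sum_list_bressoud)
  also have "\<dots> = (\<Sum>\<^sub>\<infinity>\<pi>\<in>even_above_odd_partitions. partition_monomial \<pi>)"
    by (rule infsum_reindex_bij_betw[OF bij_betw_bressoud])
  finally show "(\<Sum>\<^sub>\<infinity>\<pi>\<in>RR_partitions. partition_monomial \<pi>) =
      (\<Sum>\<^sub>\<infinity>\<pi>\<in>even_above_odd_partitions. partition_monomial \<pi>)" .
  fix N m
  \<comment> \<open>\<open>?S\<close> indexes both sides, since \<open>bressoud\<close> and
    \<open>add_staircase 1\<close> yield the same weight and number of parts.\<close>
  let ?S = "{xs \<in> ?desc. weight (bressoud xs) = N \<and> num_parts (bressoud xs) = m}"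
  have "bij_betw (add_staircase 1) ?S {\<pi> \<in> RR_partitions. weight \<pi> = N \<and> num_parts \<pi> = m}"
    by (rule bij_betw_Collect[OF bij_betw_staircase_RR]) (simp add: length_bressoud sum_list_bressoud)
  then have "card {\<pi> \<in> RR_partitions. weight \<pi> = N \<and> num_parts \<pi> = m} = card ?S"
    by (rule bij_betw_same_card[symmetric])
  moreover have "bij_betw bressoud ?S {\<pi> \<in> even_above_odd_partitions. weight \<pi> = N \<and> num_parts \<pi> = m}"
    by (rule bij_betw_Collect[OF bij_betw_bressoud]) simp
  then have "card ?S = card {\<pi> \<in> even_above_odd_partitions. weight \<pi> = N \<and> num_parts \<pi> = m}"
    by (rule bij_betw_same_card)
  ultimately show "card {\<pi> \<in> RR_partitions. weight \<pi> = N \<and> num_parts \<pi> = m} =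
      card {\<pi> \<in> even_above_odd_partitions. weight \<pi> = N \<and> num_parts \<pi> = m}"
    by simp
qed

end
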